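(* Let $\mathbf{P}=[p_{i,j}]\in\mathbb{R}^{N\times N}$ be a Markov transition matrix with $p_{i,i}\ne 1$ for all $i$, and column sums $\mathscr{C}_j=\sum_{\ell=1}^N p_{\ell,j}$. Then $$|\lambda_j|^2\le\mathscr{C}_j,$$ where $\lambda_j$ is the $j$-th eigenvalue of $\mathbf{P}$ such that $$|\lambda_j-p_{j,j}|\le\sqrt{(1-p_{j,j})(\mathscr{C}_j-p_{j,j})}.$$
   Context: A Markov transition matrix is a matrix with nonnegative entries all of whose row sums $\sum_{\ell=1}^N p_{i,\ell}$ equal $1$. Here $\lambda_j$ denotes an eigenvalue of $\mathbf{P}$ associated with the index $j$ by the displayed condition. *)

theory Defs
  imports Complex_Main "Jordan_Normal_Form.Char_Poly"
begin

definition markov_matrix :: "nat \<Rightarrow> real mat \<Rightarrow> bool" where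
  "markov_matrix N P \<longleftrightarrow>
     P \<in> carrier_mat N N \<and>
     (\<forall>i<N. \<forall>j<N. 0 \<le> P $$ (i, j)) \<and>
     (\<forall>i<N. (\<Sum>l<N. P $$ (i, l)) = 1)"

definition column_sum :: "real mat \<Rightarrow> nat \<Rightarrow> real" where
  "column_sum P j = (\<Sum>l<dim_row P. P $$ (l, j))"

end

theory Submission
  imports Defs
begin

text \<open>
  Write \<open>a\<close> for the diagonal entry and \<open>C\<close> for the column sum of index \<open>j\<close>. Nonnegativity of the
  entries together with the row and column sums gives \<open>0 \<le> a \<le> 1\<close> and \<open>a \<le> C\<close>. The triangle
  inequality puts \<open>\<bar>ev\<bar>\<close> below \<open>a + sqrt ((1 - a) * (C - a))\<close>, and this number is the inner product
  of the vectors \<open>(sqrt a, sqrt (1 - a))\<close> and \<open>(sqrt a, sqrt (C - a))\<close>, whose squared lengths are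
  \<open>1\<close> and \<open>C\<close>. The Cauchy--Schwarz inequality therefore bounds its square by \<open>C\<close>. In other words,
  the disc of the \<open>j\<close>-th localization condition lies inside the disc of radius \<open>sqrt C\<close> about the
  origin.
\<close>

text \<open>
  The planar Cauchy--Schwarz inequality for the two vectors above. With \<open>s = sqrt (1 - a)\<close> and
  \<open>t = sqrt (C - a)\<close>, the gap between the two sides is \<open>a * (s - t)\<^sup>2\<close>.
\<close>

lemma disc_reach_squared_le:
  fixes a C :: real
  assumes "0 \<le> a" "a \<le> 1" "a \<le> C"
  shows "(a + sqrt ((1 - a) * (C - a)))\<^sup>2 \<le> C"
proof -
  define s t where "s = sqrt (1 - a)" and "t = sqrt (C - a)"
  have one: "a + s\<^sup>2 = 1" and C: "a + t\<^sup>2 = C"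
    using assms by (simp_all add: s_def t_def)
  have "(a + s * t)\<^sup>2 + a * (s - t)\<^sup>2 = (a + s\<^sup>2) * (a + t\<^sup>2)"
    by (simp add: power2_eq_square algebra_simps)
  moreover have "0 \<le> a * (s - t)\<^sup>2"
    using assms(1) by simp
  ultimately have "(a + s * t)\<^sup>2 \<le> C"
    unfolding one C by simp
  then show ?thesis
    by (simp add: s_def t_def real_sqrt_mult)
qed

lemma markov_matrix_diag_bounds:
  assumes P: "markov_matrix N P" and j: "j < N"
  shows "0 \<le> P $$ (j, j)" "P $$ (j, j) \<le> 1" "P $$ (j, j) \<le> column_sum P j"
proof -
  have nonneg: "0 \<le> P $$ (i, l)" if "i < N" "l < N" for i l
    using P that by (simp add: markov_matrix_def)
  have row: "(\<Sum>l<N. P $$ (j, l)) = 1" and dim: "dim_row P = N"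
    using P j by (auto simp: markov_matrix_def)
  show "0 \<le> P $$ (j, j)"
    using nonneg j by simp
  have "P $$ (j, j) \<le> (\<Sum>l<N. P $$ (j, l))"
    by (rule member_le_sum) (use nonneg j in auto)
  then show "P $$ (j, j) \<le> 1"
    by (simp add: row)
  show "P $$ (j, j) \<le> column_sum P j"
    unfolding column_sum_def dim
    by (rule member_le_sum[where f = "\<lambda>l. P $$ (l, j)"]) (use nonneg j in auto)
qed

theorem lemma6:
  fixes P :: "real mat" and N j :: nat and ev :: complex
  assumes "markov_matrix N P"
    and "\<And>i. i < N \<Longrightarrow> P $$ (i, i) \<noteq> 1"
    and "j < N"
    and "eigenvalue (map_mat complex_of_real P) ev"
    and "cmod (ev - complex_of_real (P $$ (j, j)))
           \<le> sqrt ((1 - P $$ (j, j)) * (column_sum P j - P $$ (j, j)))"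
  shows "(cmod ev)\<^sup>2 \<le> column_sum P j"
proof -
  note diag = markov_matrix_diag_bounds[OF assms(1,3)]
  have "cmod ev \<le> cmod (complex_of_real (P $$ (j, j))) + cmod (ev - complex_of_real (P $$ (j, j)))"
    by (rule norm_triangle_sub)
  also have "\<dots> \<le> P $$ (j, j) + sqrt ((1 - P $$ (j, j)) * (column_sum P j - P $$ (j, j)))"
    using assms(5) diag(1) by simp
  finally have "(cmod ev)\<^sup>2
      \<le> (P $$ (j, j) + sqrt ((1 - P $$ (j, j)) * (column_sum P j - P $$ (j, j))))\<^sup>2"
    by (rule power_mono) simp
  also have "\<dots> \<le> column_sum P j"
    using diag by (rule disc_reach_squared_le)
  finally show ?thesis .
qed

end
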